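(* Let $(M,\Pi,D)$ be an exact Poisson manifold with $\Pi$ nondegenerate, let $\omega$ be the associated symplectic form, and set $\theta:=-i_D\omega$. Let $\Phi:\mathbb{R}^+\times M\to M$ be a conformally Poisson action of degree $c\in\mathbb{R}$, let $J:M\to\mathbb{R}$ be a conformal momentum map of degree $c$ for this action, and let $H\in C^\infty(M)$ be conformally invariant (of some degree $b\in\mathbb{R}$) under $\Phi$. For $\xi\in\mathbb{R}$ put $H_\xi=H-J_\xi$. Then a point $z_e\in M$ is a conformal relative equilibrium of $X_H$ with velocity $\xi\in\mathbb{R}$ if and only if $$dH_\xi(z_e)+(c\xi)\,\theta(z_e)=0.$$
   Context: $\mathbb{R}^+$ is the multiplicative group of positive reals, with Lie algebra identified with $\mathbb{R}$. An exact Poisson manifold $(M,\Pi,D)$ is a Poisson manifold $(M,\Pi)$ together with a vector field $D$ such that $\mathcal{L}_D\Pi=-\Pi$. The bundle map $\Pi^\sharp:T^*M\to TM$ is $\Pi^\sharp(\alpha)=\Pi(\alpha,\cdot)$; $\Pi$ is nondegenerate if $\Pi^\sharp$ is an isomorphism. The symplectic form $\omega$ associated with a nondegenerate $\Pi$ is the one for which $\omega^\flat:TM\to T^*M$, $\omega^\flat(X)=i_X\omega=\omega(X,\cdot)$, is the inverse of $\Pi^\sharp$. The Hamiltonian vector field of $H$ is $X_H=\Pi^\sharp(dH)$. A smooth action $\Phi$ is conformally Poisson of degree $c$ if $(\Phi_s)_*\Pi=s^c\Pi$ for all $s\in\mathbb{R}^+$. $H$ is conformally invariant of degree $b$ if $\Phi_s^*H=s^bH$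 for all $s\in\mathbb{R}^+$. For $\xi\in\mathbb{R}$ the infinitesimal generator is $\xi_M(x)=\frac{d}{dt}\big|_{t=0}\Phi_{e^{t\xi}}(x)$. A conformal momentum map of degree $c$ is a smooth map $J:M\to\mathbb{R}$ such that $\xi_M=\Pi^\sharp(dJ_\xi)+(c\xi)D$ for every $\xi\in\mathbb{R}$, where $J_\xi=\xi J$. A point $z_e$ is a conformal relative equilibrium of $X_H$ with velocity $\xi$ if $X_H(z_e)=\xi_M(z_e)$. *)

theory Defs
  imports "HOL-Analysis.Analysis"
begin

section \<open>Smooth manifolds\<close>

text \<open>
  The manifold is a whole type \<open>'a\<close>, Hausdorff and second countable by its type class. Its charts
  take values in a finite-dimensional normed space \<open>'e\<close>; the class \<open>euclidean_space\<close> would exclude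
  manifolds of dimension 0.
\<close>

type_synonym ('a, 'e) atlas = "('a set \<times> ('a \<Rightarrow> 'e)) set"

text \<open>
  \<open>C\<^sup>k\<close> on an open subset of a finite-dimensional space: all iterated directional derivatives up to
  order \<open>k\<close> exist and are continuous.
\<close>

primrec Ck_on :: "nat \<Rightarrow> 'e set \<Rightarrow> ('e::real_normed_vector \<Rightarrow> 'f::real_normed_vector) \<Rightarrow> bool" where
  "Ck_on 0 S f \<longleftrightarrow> continuous_on S f"
| "Ck_on (Suc k) S f \<longleftrightarrow> (\<forall>x\<in>S. f differentiable (at x)) \<and>
     (\<forall>v. Ck_on k S (\<lambda>x. frechet_derivative f (at x) v))"

definition smooth_on :: "'e set \<Rightarrow> ('e::real_normed_vector \<Rightarrow> 'f::real_normed_vector) \<Rightarrow> bool" where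
  "smooth_on S f \<longleftrightarrow> (\<forall>k. Ck_on k S f)"

definition is_chart :: "'a::topological_space set \<times> ('a \<Rightarrow> 'e::real_normed_vector) \<Rightarrow> bool" where
  "is_chart c \<longleftrightarrow> (case c of (U, \<phi>) \<Rightarrow>
     open U \<and> open (\<phi> ` U) \<and> homeomorphism U (\<phi> ` U) \<phi> (inv_into U \<phi>))"

definition carrier_of :: "('a, 'e) atlas \<Rightarrow> 'a set" where
  "carrier_of A = (\<Union>(U, \<phi>)\<in>A. U)"

definition smooth_manifold ::
  "('a::{t2_space,second_countable_topology}, 'e::real_normed_vector) atlas \<Rightarrow> bool" where
  "smooth_manifold A \<longleftrightarrow>
     (\<exists>B::'e set. finite B \<and> span B = UNIV) \<and>
     (\<forall>c\<in>A. is_chart c) \<and>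
     carrier_of A = UNIV \<and>
     (\<forall>(U, \<phi>)\<in>A. \<forall>(V, \<psi>)\<in>A. smooth_on (\<phi> ` (U \<inter> V)) (\<psi> \<circ> inv_into U \<phi>))"

definition smooth_map ::
  "('a::topological_space, 'e::real_normed_vector) atlas \<Rightarrow>
   ('b::topological_space, 'f::real_normed_vector) atlas \<Rightarrow> ('a \<Rightarrow> 'b) \<Rightarrow> bool" where
  "smooth_map A B F \<longleftrightarrow> continuous_on (carrier_of A) F \<and> F ` carrier_of A \<subseteq> carrier_of B \<and>
     (\<forall>(U, \<phi>)\<in>A. \<forall>(V, \<psi>)\<in>B. smooth_on (\<phi> ` (U \<inter> F -` V)) (\<psi> \<circ> F \<circ> inv_into U \<phi>))"

definition real_atlas :: "(real, real) atlas" where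
  "real_atlas = {(UNIV, \<lambda>t. t)}"

definition posreal_atlas :: "(real, real) atlas" where
  "posreal_atlas = {({0<..}, \<lambda>s. s)}"

definition prod_atlas :: "('a, 'e) atlas \<Rightarrow> ('b, 'f) atlas \<Rightarrow> ('a \<times> 'b, 'e \<times> 'f) atlas" where
  "prod_atlas A B = {(U \<times> V, map_prod \<phi> \<psi>) | U \<phi> V \<psi>. (U, \<phi>) \<in> A \<and> (V, \<psi>) \<in> B}"

definition smooth_fun ::
  "('a::topological_space, 'e::real_normed_vector) atlas \<Rightarrow> ('a \<Rightarrow> real) \<Rightarrow> bool" where
  "smooth_fun A f \<longleftrightarrow> smooth_map A real_atlas f"

section \<open>Tangent and cotangent vectors\<close>

text \<open>
  Tangent vectors at \<open>p\<close> are derivations at \<open>p\<close> of the algebra of smooth functions. To have equality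
  of HOL functions coincide with equality of tangent vectors, a tangent vector takes the value 0 on
  functions that are not smooth; likewise a covector at \<open>p\<close> takes the value 0 outside the tangent
  space at \<open>p\<close>.
\<close>

type_synonym 'a tvec = "('a \<Rightarrow> real) \<Rightarrow> real"
type_synonym 'a cvec = "'a tvec \<Rightarrow> real"
type_synonym 'a bivec = "'a cvec \<Rightarrow> 'a cvec \<Rightarrow> real"

context
  fixes A :: "('a::topological_space, 'e::real_normed_vector) atlas"
begin

definition tangent_space :: "'a \<Rightarrow> 'a tvec set" where
  "tangent_space p = {v.
     (\<forall>f g. smooth_fun A f \<longrightarrow> smooth_fun A g \<longrightarrow> v (\<lambda>x. f x + g x) = v f + v g) \<and>
     (\<forall>a f. smooth_fun A f \<longrightarrow> v (\<lambda>x. a * f x) = a * v f) \<and>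
     (\<forall>f g. smooth_fun A f \<longrightarrow> smooth_fun A g \<longrightarrow> v (\<lambda>x. f x * g x) = f p * v g + g p * v f) \<and>
     (\<forall>f. \<not> smooth_fun A f \<longrightarrow> v f = 0)}"

definition cotangent_space :: "'a \<Rightarrow> 'a cvec set" where
  "cotangent_space p = {\<alpha>.
     (\<forall>v\<in>tangent_space p. \<forall>w\<in>tangent_space p. \<alpha> (\<lambda>f. v f + w f) = \<alpha> v + \<alpha> w) \<and>
     (\<forall>a. \<forall>v\<in>tangent_space p. \<alpha> (\<lambda>f. a * v f) = a * \<alpha> v) \<and>
     (\<forall>v. v \<notin> tangent_space p \<longrightarrow> \<alpha> v = 0)}"

definition differential :: "('a \<Rightarrow> real) \<Rightarrow> 'a \<Rightarrow> 'a cvec" where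
  "differential f p = (\<lambda>v. if v \<in> tangent_space p then v f else 0)"

definition vector_field :: "('a \<Rightarrow> 'a tvec) \<Rightarrow> bool" where
  "vector_field X \<longleftrightarrow> (\<forall>p. X p \<in> tangent_space p) \<and>
     (\<forall>f. smooth_fun A f \<longrightarrow> smooth_fun A (\<lambda>p. X p f))"

definition one_form :: "('a \<Rightarrow> 'a cvec) \<Rightarrow> bool" where
  "one_form \<alpha> \<longleftrightarrow> (\<forall>p. \<alpha> p \<in> cotangent_space p) \<and>
     (\<forall>X. vector_field X \<longrightarrow> smooth_fun A (\<lambda>p. \<alpha> p (X p)))"

definition velocity :: "(real \<Rightarrow> 'a) \<Rightarrow> real \<Rightarrow> 'a tvec" where
  "velocity \<gamma> t\<^sub>0 = (\<lambda>f. if smooth_fun A f then deriv (\<lambda>t. f (\<gamma> t)) t\<^sub>0 else 0)"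

definition tangent_map :: "('a \<Rightarrow> 'a) \<Rightarrow> 'a tvec \<Rightarrow> 'a tvec" where
  "tangent_map F v = (\<lambda>f. if smooth_fun A f then v (f \<circ> F) else 0)"

definition cotangent_pullback :: "('a \<Rightarrow> 'a) \<Rightarrow> 'a \<Rightarrow> 'a cvec \<Rightarrow> 'a cvec" where
  "cotangent_pullback F p \<beta> = (\<lambda>v. if v \<in> tangent_space p then \<beta> (tangent_map F v) else 0)"

section \<open>Bivector fields and Lie derivatives\<close>

text \<open>
  The Poisson tensor is called \<open>P\<close>, since capital Pi is reserved for dependent function spaces. The
  values of a bivector field at \<open>p\<close> matter only on covectors at \<open>p\<close>.
\<close>

definition bivector_field :: "('a \<Rightarrow> 'a bivec) \<Rightarrow> bool" where
  "bivector_field P \<longleftrightarrow>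
     (\<forall>p. \<forall>\<alpha>\<in>cotangent_space p. \<forall>\<beta>\<in>cotangent_space p. \<forall>\<gamma>\<in>cotangent_space p. \<forall>a b.
        P p (\<lambda>v. a * \<alpha> v + b * \<beta> v) \<gamma> = a * P p \<alpha> \<gamma> + b * P p \<beta> \<gamma>) \<and>
     (\<forall>p. \<forall>\<alpha>\<in>cotangent_space p. \<forall>\<beta>\<in>cotangent_space p. P p \<alpha> \<beta> = - P p \<beta> \<alpha>) \<and>
     (\<forall>\<alpha> \<beta>. one_form \<alpha> \<longrightarrow> one_form \<beta> \<longrightarrow> smooth_fun A (\<lambda>p. P p (\<alpha> p) (\<beta> p)))"

definition bivec_eq :: "('a \<Rightarrow> 'a bivec) \<Rightarrow> ('a \<Rightarrow> 'a bivec) \<Rightarrow> bool" where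
  "bivec_eq P P' \<longleftrightarrow>
     (\<forall>p. \<forall>\<alpha>\<in>cotangent_space p. \<forall>\<beta>\<in>cotangent_space p. P p \<alpha> \<beta> = P' p \<alpha> \<beta>)"

text \<open>The push-forward of a bivector field along a diffeomorphism \<open>F\<close>.\<close>

definition pushforward :: "('a \<Rightarrow> 'a) \<Rightarrow> ('a \<Rightarrow> 'a bivec) \<Rightarrow> 'a \<Rightarrow> 'a bivec" where
  "pushforward F P q = (\<lambda>\<alpha> \<beta>. let p = inv F q in
     P p (cotangent_pullback F p \<alpha>) (cotangent_pullback F p \<beta>))"

definition lie_bracket :: "('a \<Rightarrow> 'a tvec) \<Rightarrow> ('a \<Rightarrow> 'a tvec) \<Rightarrow> 'a \<Rightarrow> 'a tvec" where
  "lie_bracket X Y p =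
     (\<lambda>f. if smooth_fun A f then X p (\<lambda>q. Y q f) - Y p (\<lambda>q. X q f) else 0)"

text \<open>
  Lie derivatives of one-forms and bivector fields are given by the Leibniz rule:
  \<open>(L\<^sub>X \<alpha>)(Y) = X (\<alpha> Y) - \<alpha> [X, Y]\<close> and
  \<open>(L\<^sub>X P)(\<alpha>, \<beta>) = X (P(\<alpha>, \<beta>)) - P(L\<^sub>X \<alpha>, \<beta>) - P(\<alpha>, L\<^sub>X \<beta>)\<close>.
  The first depends on \<open>Y\<close> only through its value at the point considered, so any vector field
  extending the given tangent vector \<open>v\<close> may be used for \<open>Y\<close>.
\<close>

definition lie_derivative_form ::
  "('a \<Rightarrow> 'a tvec) \<Rightarrow> ('a \<Rightarrow> 'a cvec) \<Rightarrow> 'a \<Rightarrow> 'a cvec" where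
  "lie_derivative_form X \<alpha> p = (\<lambda>v. if v \<in> tangent_space p
     then let Y = (SOME Y. vector_field Y \<and> Y p = v)
          in X p (\<lambda>q. \<alpha> q (Y q)) - \<alpha> p (lie_bracket X Y p)
     else 0)"

definition lie_derivative_bivec ::
  "('a \<Rightarrow> 'a tvec) \<Rightarrow> ('a \<Rightarrow> 'a bivec) \<Rightarrow> ('a \<Rightarrow> 'a cvec) \<Rightarrow> ('a \<Rightarrow> 'a cvec) \<Rightarrow> 'a \<Rightarrow> real" where
  "lie_derivative_bivec X P \<alpha> \<beta> p =
     X p (\<lambda>q. P q (\<alpha> q) (\<beta> q))
     - P p (lie_derivative_form X \<alpha> p) (\<beta> p)
     - P p (\<alpha> p) (lie_derivative_form X \<beta> p)"

section \<open>Exact Poisson manifolds\<close>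

definition poisson_bracket ::
  "('a \<Rightarrow> 'a bivec) \<Rightarrow> ('a \<Rightarrow> real) \<Rightarrow> ('a \<Rightarrow> real) \<Rightarrow> 'a \<Rightarrow> real" where
  "poisson_bracket P f g p = P p (differential f p) (differential g p)"

definition poisson_bivector :: "('a \<Rightarrow> 'a bivec) \<Rightarrow> bool" where
  "poisson_bivector P \<longleftrightarrow> bivector_field P \<and>
     (\<forall>f g h. smooth_fun A f \<longrightarrow> smooth_fun A g \<longrightarrow> smooth_fun A h \<longrightarrow>
        (\<forall>p. poisson_bracket P f (poisson_bracket P g h) p
           + poisson_bracket P g (poisson_bracket P h f) p
           + poisson_bracket P h (poisson_bracket P f g) p = 0))"

text \<open>
  \<open>P\<^sup>\<sharp>(\<alpha>) = P(\<alpha>, \<cdot>)\<close>: the linear form \<open>P(\<alpha>, \<cdot>)\<close> on the cotangent space is the tangent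
  vector \<open>v\<close> with \<open>v f = df(v) = P(\<alpha>, df)\<close> for smooth \<open>f\<close>.
\<close>

definition sharp :: "('a \<Rightarrow> 'a bivec) \<Rightarrow> 'a \<Rightarrow> 'a cvec \<Rightarrow> 'a tvec" where
  "sharp P p \<alpha> = (\<lambda>f. if smooth_fun A f then P p \<alpha> (differential f p) else 0)"

definition nondegenerate :: "('a \<Rightarrow> 'a bivec) \<Rightarrow> bool" where
  "nondegenerate P \<longleftrightarrow> (\<forall>p. bij_betw (sharp P p) (cotangent_space p) (tangent_space p))"

definition symplectic_form :: "('a \<Rightarrow> 'a bivec) \<Rightarrow> 'a \<Rightarrow> 'a tvec \<Rightarrow> 'a tvec \<Rightarrow> real" where
  "symplectic_form P p v w = inv_into (cotangent_space p) (sharp P p) v w"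

definition hamiltonian_vf :: "('a \<Rightarrow> 'a bivec) \<Rightarrow> ('a \<Rightarrow> real) \<Rightarrow> 'a \<Rightarrow> 'a tvec" where
  "hamiltonian_vf P H p = sharp P p (differential H p)"

end

definition interior_product ::
  "('a \<Rightarrow> 'a tvec) \<Rightarrow> ('a \<Rightarrow> 'a tvec \<Rightarrow> 'a tvec \<Rightarrow> real) \<Rightarrow> 'a \<Rightarrow> 'a cvec" where
  "interior_product X \<omega> p = (\<lambda>w. \<omega> p (X p) w)"

definition exact_poisson_manifold ::
  "('a::{t2_space,second_countable_topology}, 'e::real_normed_vector) atlas \<Rightarrow>
   ('a \<Rightarrow> 'a bivec) \<Rightarrow> ('a \<Rightarrow> 'a tvec) \<Rightarrow> bool" where
  "exact_poisson_manifold A P D \<longleftrightarrow>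
     smooth_manifold A \<and> poisson_bivector A P \<and> vector_field A D \<and>
     (\<forall>\<alpha> \<beta>. one_form A \<alpha> \<longrightarrow> one_form A \<beta> \<longrightarrow>
        (\<forall>p. lie_derivative_bivec A D P \<alpha> \<beta> p = - P p (\<alpha> p) (\<beta> p)))"

section \<open>Conformal actions and momentum maps\<close>

context
  fixes A :: "('a::topological_space, 'e::real_normed_vector) atlas"
begin

text \<open>Only the values \<open>\<Phi> s\<close> for \<open>s > 0\<close> are relevant.\<close>

definition smooth_action :: "(real \<Rightarrow> 'a \<Rightarrow> 'a) \<Rightarrow> bool" where
  "smooth_action \<Phi> \<longleftrightarrow>
     smooth_map (prod_atlas posreal_atlas A) A (\<lambda>(s, x). \<Phi> s x) \<and>
     (\<forall>x. \<Phi> 1 x = x) \<and>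
     (\<forall>s>0. \<forall>t>0. \<forall>x. \<Phi> (s * t) x = \<Phi> s (\<Phi> t x))"

definition conformally_poisson :: "('a \<Rightarrow> 'a bivec) \<Rightarrow> (real \<Rightarrow> 'a \<Rightarrow> 'a) \<Rightarrow> real \<Rightarrow> bool" where
  "conformally_poisson P \<Phi> c \<longleftrightarrow> smooth_action \<Phi> \<and>
     (\<forall>s>0. bivec_eq A (pushforward A (\<Phi> s) P) (\<lambda>p \<alpha> \<beta>. s powr c * P p \<alpha> \<beta>))"

definition conformally_invariant :: "(real \<Rightarrow> 'a \<Rightarrow> 'a) \<Rightarrow> ('a \<Rightarrow> real) \<Rightarrow> real \<Rightarrow> bool" where
  "conformally_invariant \<Phi> H b \<longleftrightarrow> (\<forall>s>0. \<forall>x. H (\<Phi> s x) = s powr b * H x)"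

definition inf_generator :: "(real \<Rightarrow> 'a \<Rightarrow> 'a) \<Rightarrow> real \<Rightarrow> 'a \<Rightarrow> 'a tvec" where
  "inf_generator \<Phi> \<xi> x = velocity A (\<lambda>t. \<Phi> (exp (t * \<xi>)) x) 0"

definition momentum_component :: "('a \<Rightarrow> real) \<Rightarrow> real \<Rightarrow> 'a \<Rightarrow> real" where
  "momentum_component J \<xi> = (\<lambda>x. \<xi> * J x)"

definition conformal_momentum_map ::
  "('a \<Rightarrow> 'a bivec) \<Rightarrow> ('a \<Rightarrow> 'a tvec) \<Rightarrow> (real \<Rightarrow> 'a \<Rightarrow> 'a) \<Rightarrow> real \<Rightarrow> ('a \<Rightarrow> real) \<Rightarrow> bool" where
  "conformal_momentum_map P D \<Phi> c J \<longleftrightarrow> smooth_fun A J \<and>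
     (\<forall>\<xi> p. inf_generator \<Phi> \<xi> p =
        (\<lambda>f. sharp A P p (differential A (momentum_component J \<xi>) p) f + (c * \<xi>) * D p f))"

definition conformal_relative_equilibrium ::
  "('a \<Rightarrow> 'a bivec) \<Rightarrow> (real \<Rightarrow> 'a \<Rightarrow> 'a) \<Rightarrow> ('a \<Rightarrow> real) \<Rightarrow> real \<Rightarrow> 'a \<Rightarrow> bool" where
  "conformal_relative_equilibrium P \<Phi> H \<xi> z \<longleftrightarrow> hamiltonian_vf A P H z = inf_generator \<Phi> \<xi> z"

end

end

theory Submission
  imports Defs
begin

text \<open>
  On covectors \<open>P\<^sup>\<sharp>\<close> is linear with inverse \<open>\<omega>\<^sup>\<flat>\<close>, so \<open>\<theta> = - \<omega>\<^sup>\<flat>(D)\<close> means \<open>D = - P\<^sup>\<sharp>(\<theta>)\<close>. The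
  momentum map condition turns \<open>X\<^sub>H = \<xi>\<^sub>M\<close> at a point into \<open>P\<^sup>\<sharp>(dH) = P\<^sup>\<sharp>(dJ\<^sub>\<xi> - c \<xi> \<theta>)\<close>, and
  injectivity of \<open>P\<^sup>\<sharp>\<close> cancels \<open>P\<^sup>\<sharp>\<close>.
\<close>

text \<open>A derivative at a point of an open set sees only values near that point. Higher
  derivatives of \<open>f\<close> and \<open>g\<close> are again known to agree only on
  \<open>S\<close>, so the induction must vary both functions.\<close>

lemma Ck_on_cong:
  assumes "open S" "\<And>x. x \<in> S \<Longrightarrow> f x = g x" "Ck_on k S f"
  shows "Ck_on k S g"
  using assms(2,3)
proof (induction k arbitrary: f g)
  case 0
  then show ?case
    unfolding Ck_on.simps by (blast intro: continuous_on_eq)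
next
  case (Suc k)
  have der: "(g has_derivative frechet_derivative f (at x)) (at x)" if "x \<in> S" for x
  proof -
    have "(f has_derivative frechet_derivative f (at x)) (at x)"
      using Suc.prems(2) that frechet_derivative_works by auto
    then show ?thesis
      using \<open>open S\<close> that Suc.prems(1) by (rule has_derivative_transform_within_open)
  qed
  have "frechet_derivative f (at x) = frechet_derivative g (at x)" if "x \<in> S" for x
    using der[OF that] by (rule frechet_derivative_at)
  moreover have "Ck_on k S (\<lambda>x. frechet_derivative f (at x) v)" for v
    using Suc.prems(2) by simp
  ultimately have "Ck_on k S (\<lambda>x. frechet_derivative g (at x) v)" for v
    by (metis (mono_tags, lifting) Suc.IH)
  with der show ?case
    by (auto intro: differentiableI)
qed

text \<open>The chain rule turns each directional derivative of the composite into \<open>L\<close>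
  applied to one of \<open>f\<close>, which is the same shape one order lower.\<close>

lemma Ck_on_bounded_linear:
  assumes "bounded_linear L" "open S" "Ck_on k S f"
  shows "Ck_on k S (\<lambda>x. L (f x))"
  using assms(3)
proof (induction k arbitrary: f)
  case 0
  then show ?case
    using bounded_linear.continuous_on[OF assms(1)] by simp
next
  case (Suc k)
  have der: "((\<lambda>x. L (f x)) has_derivative (\<lambda>v. L (frechet_derivative f (at x) v))) (at x)"
    if "x \<in> S" for x
    using Suc.prems that
    by (auto intro!: bounded_linear.has_derivative[OF assms(1)]
        simp: frechet_derivative_works[symmetric])
  have "Ck_on k S (\<lambda>x. frechet_derivative (\<lambda>x. L (f x)) (at x) v)" for v
  \<comment> \<open>The chain rule is available only at points of \<open>S\<close>; outside,
    \<open>frechet_derivative\<close> may be arbitrary, so the two derivative functions cannot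
    simply be identified.\<close>
  proof (rule Ck_on_cong[OF \<open>open S\<close>])
    show "L (frechet_derivative f (at x) v) = frechet_derivative (\<lambda>x. L (f x)) (at x) v"
      if "x \<in> S" for x
      using frechet_derivative_at[OF der[OF that]] by metis
    show "Ck_on k S (\<lambda>x. L (frechet_derivative f (at x) v))"
      using Suc.prems by (simp add: Suc.IH)
  qed
  with der show ?case
    by (auto intro: differentiableI)
qed

text \<open>Tangent vectors obey their algebraic laws only on smooth functions, so multiples such as
  \<open>- g\<close> and \<open>momentum_component J \<xi>\<close> must be known to be smooth before
  a derivation can be split over them.\<close>

lemma smooth_fun_mult_const:
  assumes charts: "\<forall>ch\<in>A. is_chart ch" and f: "smooth_fun A f"
  shows "smooth_fun A (\<lambda>x. a * f x)"
proof -
  \<comment> \<open>The only chart of \<open>real_atlas\<close> is the identity of the line, so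
    besides continuity just this coordinate expression has to be checked.\<close>
  have "smooth_on (\<phi> ` U) (\<lambda>y. a * f (inv_into U \<phi> y))" if "(U, \<phi>) \<in> A" for U \<phi>
  proof -
    have "open (\<phi> ` U)"
      using charts that by (auto simp: is_chart_def)
    moreover have "smooth_on (\<phi> ` U) (\<lambda>y. f (inv_into U \<phi> y))"
      using f that by (auto simp: smooth_fun_def smooth_map_def real_atlas_def o_def)
    ultimately show ?thesis
      unfolding smooth_on_def
      using Ck_on_bounded_linear[OF bounded_linear_mult_right] by blast
  qed
  moreover have "continuous_on (carrier_of A) (\<lambda>x. a * f x)"
    using f by (auto simp: smooth_fun_def smooth_map_def intro: continuous_on_mult_left)
  ultimately show ?thesis
    by (auto simp: smooth_fun_def smooth_map_def real_atlas_def carrier_of_def o_def)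
qed

lemma tangent_space_add:
  "v \<in> tangent_space A p \<Longrightarrow> w \<in> tangent_space A p \<Longrightarrow> (\<lambda>f. v f + w f) \<in> tangent_space A p"
  by (auto simp: tangent_space_def algebra_simps)

lemma tangent_space_scale:
  "v \<in> tangent_space A p \<Longrightarrow> (\<lambda>f. a * v f) \<in> tangent_space A p"
  by (auto simp: tangent_space_def algebra_simps)

lemma cotangent_space_lincomb:
  "\<alpha> \<in> cotangent_space A p \<Longrightarrow> \<beta> \<in> cotangent_space A p \<Longrightarrow>
   (\<lambda>v. a * \<alpha> v + b * \<beta> v) \<in> cotangent_space A p"
  by (auto simp: cotangent_space_def algebra_simps)

lemma differential_in_cotangent_space: "differential A f p \<in> cotangent_space A p"
  by (auto simp: cotangent_space_def differential_def tangent_space_add tangent_space_scale)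

lemma differential_diff:
  assumes "\<forall>ch\<in>A. is_chart ch" "smooth_fun A f" "smooth_fun A g"
  shows "differential A (\<lambda>x. f x - g x) p = (\<lambda>v. differential A f p v - differential A g p v)"
proof
  fix v
  have "v (\<lambda>x. f x - g x) = v f - v g" if v: "v \<in> tangent_space A p"
  proof -
    \<comment> \<open>Derivations are specified by sums and scalar multiples, hence the difference
      is rewritten in these terms.\<close>
    have "v (\<lambda>x. f x + (- 1) * g x) = v f + v (\<lambda>x. (- 1) * g x)"
      using v assms(2) smooth_fun_mult_const[OF assms(1,3)] unfolding tangent_space_def by blast
    also have "v (\<lambda>x. (- 1) * g x) = (- 1) * v g"
      using v assms(3) unfolding tangent_space_def by blast
    finally show ?thesis
      by simp
  qed
  then show "differential A (\<lambda>x. f x - g x) p v = differential A f p v - differential A g p v"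
    by (simp add: differential_def)
qed

text \<open>Linearity of \<open>P\<close> in its first slot gives this on smooth functions; on all
  others both sides take the default value 0, so the equality holds between HOL functions.\<close>

lemma sharp_lincomb:
  assumes "bivector_field A P" "\<alpha> \<in> cotangent_space A p" "\<beta> \<in> cotangent_space A p"
  shows "sharp A P p (\<lambda>v. a * \<alpha> v + b * \<beta> v) =
    (\<lambda>f. a * sharp A P p \<alpha> f + b * sharp A P p \<beta> f)"
proof
  fix f
  have "P p (\<lambda>v. a * \<alpha> v + b * \<beta> v) (differential A f p) =
      a * P p \<alpha> (differential A f p) + b * P p \<beta> (differential A f p)"
    using assms differential_in_cotangent_space[of A f p] unfolding bivector_field_def by blast
  then show "sharp A P p (\<lambda>v. a * \<alpha> v + b * \<beta> v) f =
      a * sharp A P p \<alpha> f + b * sharp A P p \<beta> f"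
    by (simp add: sharp_def)
qed

theorem corollary4p2:
  fixes A :: "('a::{t2_space,second_countable_topology}, 'e::real_normed_vector) atlas"
    and P :: "'a \<Rightarrow> 'a bivec" and D :: "'a \<Rightarrow> 'a tvec"
    and \<omega> :: "'a \<Rightarrow> 'a tvec \<Rightarrow> 'a tvec \<Rightarrow> real" and \<theta> :: "'a \<Rightarrow> 'a cvec"
    and \<Phi> :: "real \<Rightarrow> 'a \<Rightarrow> 'a" and J H H\<^sub>\<xi> :: "'a \<Rightarrow> real"
    and b c \<xi> :: real and z\<^sub>e :: 'a
  assumes "exact_poisson_manifold A P D"
    and "nondegenerate A P"
    and "\<omega> = symplectic_form A P"
    and "\<theta> = (\<lambda>p v. - interior_product D \<omega> p v)"
    and "conformally_poisson A P \<Phi> c"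
    and "conformal_momentum_map A P D \<Phi> c J"
    and "smooth_fun A H"
    and "conformally_invariant \<Phi> H b"
    and "H\<^sub>\<xi> = (\<lambda>x. H x - momentum_component J \<xi> x)"
  shows "conformal_relative_equilibrium A P \<Phi> H \<xi> z\<^sub>e \<longleftrightarrow>
    (\<lambda>v. differential A H\<^sub>\<xi> z\<^sub>e v + (c * \<xi>) * \<theta> z\<^sub>e v) = (\<lambda>v. 0)"
proof -
  have charts: "\<forall>ch\<in>A. is_chart ch" and P: "bivector_field A P"
    and D: "D z\<^sub>e \<in> tangent_space A z\<^sub>e"
    using assms(1)
    by (auto simp: exact_poisson_manifold_def smooth_manifold_def poisson_bivector_def
        vector_field_def)
  have bij: "bij_betw (sharp A P z\<^sub>e) (cotangent_space A z\<^sub>e) (tangent_space A z\<^sub>e)"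
    using assms(2) by (simp add: nondegenerate_def)
  \<comment> \<open>This covector is \<omega>(D, -) at the point. Surjectivity of sharp makes it a
    true preimage of \<open>D z\<^sub>e\<close>, and it equals minus \<theta> there.\<close>
  define \<kappa> where "\<kappa> = inv_into (cotangent_space A z\<^sub>e) (sharp A P z\<^sub>e) (D z\<^sub>e)"
  have \<kappa>: "\<kappa> \<in> cotangent_space A z\<^sub>e" "sharp A P z\<^sub>e \<kappa> = D z\<^sub>e"
    using bij D inv_into_into[of "D z\<^sub>e" "sharp A P z\<^sub>e" "cotangent_space A z\<^sub>e"]
    by (auto simp: \<kappa>_def bij_betw_def f_inv_into_f)
  have \<theta>: "\<theta> z\<^sub>e v = - \<kappa> v" for v
    by (simp add: assms(3,4) interior_product_def symplectic_form_def \<kappa>_def)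
  define dH where "dH = differential A H z\<^sub>e"
  define dJ where "dJ = differential A (momentum_component J \<xi>) z\<^sub>e"
  have cov: "dH \<in> cotangent_space A z\<^sub>e" "dJ \<in> cotangent_space A z\<^sub>e"
    by (simp_all add: dH_def dJ_def differential_in_cotangent_space)
  have "smooth_fun A (momentum_component J \<xi>)"
    using assms(6) smooth_fun_mult_const[OF charts]
    by (simp add: conformal_momentum_map_def momentum_component_def)
  then have dH\<xi>: "differential A H\<^sub>\<xi> z\<^sub>e = (\<lambda>v. dH v - dJ v)"
    using differential_diff[OF charts assms(7)] by (simp add: assms(9) dH_def dJ_def)
  \<comment> \<open>The factor 1 keeps the expression in the form of
    \<open>sharp_lincomb\<close>.\<close>
  have cov': "(\<lambda>v. 1 * dJ v + (c * \<xi>) * \<kappa> v) \<in> cotangent_space A z\<^sub>e"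
    using cov(2) \<kappa>(1) by (rule cotangent_space_lincomb)
  have "inf_generator A \<Phi> \<xi> z\<^sub>e = (\<lambda>f. 1 * sharp A P z\<^sub>e dJ f + (c * \<xi>) * D z\<^sub>e f)"
    using assms(6) by (simp add: conformal_momentum_map_def dJ_def)
  also have "\<dots> = sharp A P z\<^sub>e (\<lambda>v. 1 * dJ v + (c * \<xi>) * \<kappa> v)"
    by (simp only: sharp_lincomb[OF P cov(2) \<kappa>(1)] \<kappa>(2))
  finally have "conformal_relative_equilibrium A P \<Phi> H \<xi> z\<^sub>e \<longleftrightarrow>
      sharp A P z\<^sub>e dH = sharp A P z\<^sub>e (\<lambda>v. 1 * dJ v + (c * \<xi>) * \<kappa> v)"
    by (simp add: conformal_relative_equilibrium_def hamiltonian_vf_def dH_def)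
  \<comment> \<open>Injectivity holds only on the cotangent space, which is why both arguments were
    shown to be covectors.\<close>
  also have "\<dots> \<longleftrightarrow> dH = (\<lambda>v. 1 * dJ v + (c * \<xi>) * \<kappa> v)"
    using bij cov(1) cov' by (auto simp: bij_betw_def dest: inj_on_eq_iff)
  also have "\<dots> \<longleftrightarrow> (\<lambda>v. differential A H\<^sub>\<xi> z\<^sub>e v + (c * \<xi>) * \<theta> z\<^sub>e v) = (\<lambda>v. 0)"
    by (simp add: dH\<xi> \<theta> fun_eq_iff algebra_simps)
  finally show ?thesis .
qed

end
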